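(* Let $n$ be a positive integer and $1\leq i\leq n$. Then \[ \mathbf{B}_{n,i}(t)=2^{n-i}\sum_{j=0}^{i-1}\binom{i-1}{j}\,\mathbf{A}_{n,i-j}(t). \]
   Context: For a permutation $\pi=\pi_1\cdots\pi_n$ of $[n]=\{1,\dots,n\}$, $\mathrm{des}(\pi)=|\{k\in[n-1]:\pi_k>\pi_{k+1}\}|$. For $1\le j\le n$, $\mathfrak{S}_{n,j}$ is the set of permutations of $[n]$ with $\pi_n=j$, and $\mathbf{A}_{n,j}(t)=\sum_{\pi\in\mathfrak{S}_{n,j}}t^{\mathrm{des}(\pi)}$. The hyperoctahedral group $\mathfrak{B}_n$ is the set of signed permutations $\pi=\pi_1\cdots\pi_n$ (words in which each of $1,\dots,n$ appears exactly once up to sign, each entry carrying a sign $\pm$). With the convention $\pi_0=0$, $\mathrm{des}_B(\pi)=|\{k\in\{0,1,\dots,n-1\}:\pi_k>\pi_{k+1}\}|$. For $j\in\{\pm1,\dots,\pm n\}$, $\mathfrak{B}_{n,j}=\{\pi\in\mathfrak{B}_n:\pi_n=j\}$ and $\mathbf{B}_{n,j}(t)=\sum_{\pi\in\mathfrak{B}_{n,j}}t^{\mathrm{des}_B(\pi)}$. *)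

theory Defs
  imports
    "HOL-Computational_Algebra.Polynomial"
    "HOL-Combinatorics.Multiset_Permutations"
begin

text \<open>
  Permutations are words, i.e. lists; the entry \<open>\<pi>\<^sub>k\<close> is \<open>w ! (k - 1)\<close>.
\<close>

definition des :: "'a::linorder list \<Rightarrow> nat" where
  "des w = card {k \<in> {1..<length w}. w ! (k - 1) > w ! k}"

definition perms_last :: "nat \<Rightarrow> nat \<Rightarrow> nat list set" where
  "perms_last n j = {w \<in> permutations_of_set {1..n}. last w = j}"

definition A_poly :: "nat \<Rightarrow> nat \<Rightarrow> int poly" where
  "A_poly n j = (\<Sum>w\<in>perms_last n j. monom 1 (des w))"

definition signed_perms :: "nat \<Rightarrow> int list set" where
  "signed_perms n = {w. map abs w \<in> permutations_of_set {1..int n}}"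

text \<open>
  In \<open>0 # w\<close> the entry at index \<open>k\<close> is \<open>\<pi>\<^sub>k\<close>, with the convention \<open>\<pi>\<^sub>0 = 0\<close>.
\<close>

definition des_B :: "int list \<Rightarrow> nat" where
  "des_B w = card {k \<in> {0..<length w}. (0 # w) ! k > (0 # w) ! (k + 1)}"

definition signed_perms_last :: "nat \<Rightarrow> int \<Rightarrow> int list set" where
  "signed_perms_last n j = {w \<in> signed_perms n. last w = j}"

definition B_poly :: "nat \<Rightarrow> int \<Rightarrow> int poly" where
  "B_poly n j = (\<Sum>w\<in>signed_perms_last n j. monom 1 (des_B w))"

end

theory Submission
  imports Defs
begin

text \<open>
  Fix the set \<open>S\<close> of absolute values that carry a minus sign. Moving the negative letters, in
  their given order, above all positive ones is a cyclic rotation of the alphabet together with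
  \<open>\<pi>\<^sub>0 = 0\<close>, and it preserves the number of cyclic descents of \<open>0\<pi>\<^sub>1\<cdots>\<pi>\<^sub>n\<close>. If \<open>\<pi>\<^sub>n = i > 0\<close>, the
  cyclic step from \<open>\<pi>\<^sub>n\<close> back to \<open>0\<close> is a descent before and after the rotation, so
  \<open>des\<^sub>B(\<pi>)\<close> is the number of descents of an ordinary permutation of \<open>[n]\<close> whose last letter is
  \<open>i - j\<close>, where \<open>j\<close> is the number of elements of \<open>S\<close> below \<open>i\<close>. For a given \<open>j\<close> there are
  \<open>(i-1 choose j) \<cdot> 2\<^sup>n\<^sup>-\<^sup>i\<close> such sets \<open>S\<close>.
\<close>

section \<open>Descents of words and how a rotation of the alphabet changes them\<close>

lemma des_singleton [simp]: "des [x] = 0"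
  by (simp add: des_def)

lemma des_Cons_Cons [simp]:
  "des (x # y # zs) = of_bool (y < x) + des (y # zs)"
proof -
  let ?D = "{k \<in> {1..<length (y # zs)}. (y # zs) ! (k - 1) > (y # zs) ! k}"
  let ?E = "{k \<in> {1..<length (x # y # zs)}. (x # y # zs) ! (k - 1) > (x # y # zs) ! k}"
  have "k \<in> ?E \<longleftrightarrow> k \<in> (if y < x then {1} else {}) \<union> Suc ` ?D" for k
  proof (cases k)
    case (Suc m)
    then show ?thesis by (cases m) (auto simp: image_iff)
  qed auto
  then have "?E = (if y < x then {1} else {}) \<union> Suc ` ?D" by blast
  moreover have "card ((if y < x then {1} else {}) \<union> Suc ` ?D) = of_bool (y < x) + card ?D"
    by (subst card_Un_disjoint) (auto simp: card_image)
  ultimately show ?thesis by (simp add: des_def)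
qed

text \<open>Only an index shift: \<open>des_B\<close> numbers the descents of \<open>0 # w\<close>
  from 0, \<open>des\<close> from 1.\<close>

lemma des_B_eq_des: "des_B w = des (0 # w)"
proof -
  have "{k \<in> {1..<length (0 # w)}. (0 # w) ! (k - 1) > (0 # w) ! k} =
      Suc ` {k \<in> {0..<length w}. (0 # w) ! k > (0 # w) ! (k + 1)}" (is "?L = ?R")
  proof (intro set_eqI)
    show "k \<in> ?L \<longleftrightarrow> k \<in> ?R" for k by (cases k) (auto simp: image_iff)
  qed
  then show ?thesis by (simp add: des_def des_B_def card_image)
qed

text \<open>The hypothesis \<open>rot\<close> says that \<open>f\<close> lifts the negative letters
  above all others and otherwise keeps the order. Each adjacent pair \<open>x\<close>,
  \<open>y\<close> then satisfies \<open>[y < x] + [x < 0] = [f y < f x] + [y < 0]\<close>. Adding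
  these up along the word telescopes, leaving only the signs of its first and last letters.\<close>

lemma des_map_rotate:
  fixes f :: "int \<Rightarrow> 'a::linorder"
  assumes "set w \<subseteq> V" "w \<noteq> []"
    and rot: "\<And>x y. \<lbrakk>x \<in> V; y \<in> V\<rbrakk> \<Longrightarrow>
      f y < f x \<longleftrightarrow> (if x < 0 \<longleftrightarrow> y < 0 then y < x else x < 0)"
  shows "des w + of_bool (hd w < 0) = des (map f w) + of_bool (last w < 0)"
  using assms(1,2)
proof (induction w rule: induct_list012)
  case (3 x y zs)
  then have "des (y # zs) + of_bool (y < 0) =
      des (map f (y # zs)) + of_bool (last (y # zs) < 0)" by simp
  with 3 rot[of x y] show ?case by (auto split: if_splits)
qed auto

text \<open>The boundary terms of \<open>des_map_rotate\<close> are now absorbed: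
  \<open>hd w < 0\<close> is exactly the descent from the leading 0, and the term for the last
  letter vanishes.\<close>

lemma des_B_map_rotate:
  fixes f :: "int \<Rightarrow> 'a::linorder"
  assumes "set w \<subseteq> V" "w \<noteq> []" "0 < last w"
    and rot: "\<And>x y. \<lbrakk>x \<in> V; y \<in> V\<rbrakk> \<Longrightarrow>
      f y < f x \<longleftrightarrow> (if x < 0 \<longleftrightarrow> y < 0 then y < x else x < 0)"
  shows "des_B w = des (map f w)"
proof -
  obtain x zs where "w = x # zs" using assms(2) by (cases w) auto
  then show ?thesis
    using des_map_rotate[of w V f] assms by (simp add: des_B_eq_des)
qed

section \<open>Relabelling a signed alphabet by its rotated order\<close>

text \<open>For nonzero \<open>v\<close> in \<open>V\<close>, the position of \<open>v\<close>,
  counted from 1, when the positive letters of \<open>V\<close> are listed in increasing order,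
  followed by the negative ones in increasing order.\<close>

definition rotated_rank :: "int set \<Rightarrow> int \<Rightarrow> nat" where
  "rotated_rank V v = (if v < 0 then card {u \<in> V. u > 0 \<or> u \<le> v} else card {u \<in> V. 0 < u \<and> u \<le> v})"

text \<open>The initial segments counted by the ranks are nested, and \<open>x\<close> itself
  separates the two.\<close>

lemma rotated_rank_less:
  assumes "finite V" "0 \<notin> V" "x \<in> V" "y \<in> V"
    and "if x < 0 \<longleftrightarrow> y < 0 then y < x else x < 0"
  shows "rotated_rank V y < rotated_rank V x"
proof -
  have nz: "x \<noteq> 0" "y \<noteq> 0" using assms by auto
  define R where "R v = (if v < 0 then {u \<in> V. u > 0 \<or> u \<le> v} else {u \<in> V. 0 < u \<and> u \<le> v})" for v
  have "x \<in> R x" "x \<notin> R y" "R y \<subseteq> R x"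
    using assms nz by (auto simp: R_def split: if_splits)
  then have "R y \<subset> R x" by blast
  moreover have "finite (R x)" using assms by (auto simp: R_def)
  ultimately have "card (R y) < card (R x)" by (rule psubset_card_mono[rotated])
  then show ?thesis by (simp add: rotated_rank_def R_def split: if_splits)
qed

lemma rotated_rank_less_iff:
  assumes "finite V" "0 \<notin> V" "x \<in> V" "y \<in> V"
  shows "rotated_rank V y < rotated_rank V x \<longleftrightarrow> (if x < 0 \<longleftrightarrow> y < 0 then y < x else x < 0)"
  using rotated_rank_less[OF assms] rotated_rank_less[OF assms(1,2,4,3)]
  by (cases x y rule: linorder_cases) (auto split: if_splits)

lemma bij_betw_rotated_rank:
  assumes "finite V" "0 \<notin> V"
  shows "bij_betw (rotated_rank V) V {1..card V}"
proof -
  have inj: "inj_on (rotated_rank V) V"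
  proof (rule inj_onI)
    fix x y assume "x \<in> V" "y \<in> V" "rotated_rank V x = rotated_rank V y"
    then show "x = y"
      using rotated_rank_less_iff[OF assms, of x y] rotated_rank_less_iff[OF assms, of y x]
      by (auto split: if_splits)
  qed
  have "rotated_rank V ` V \<subseteq> {1..card V}"
  proof (rule image_subsetI)
    fix v assume v: "v \<in> V"
    then have "v \<noteq> 0" using assms by auto
    define R where "R = (if v < 0 then {u \<in> V. u > 0 \<or> u \<le> v} else {u \<in> V. 0 < u \<and> u \<le> v})"
    \<comment> \<open>A nonzero letter lies in its own segment, so ranks start at 1.\<close>
    have "{v} \<subseteq> R" "R \<subseteq> V" using v \<open>v \<noteq> 0\<close> by (auto simp: R_def)
    then have "card {v} \<le> card R" "card R \<le> card V"
      using assms finite_subset[of R V] by (auto intro!: card_mono simp del: card.empty card_insert_disjoint)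
    moreover have "rotated_rank V v = card R" by (simp add: rotated_rank_def R_def)
    ultimately show "rotated_rank V v \<in> {1..card V}" by simp
  qed
  moreover have "card (rotated_rank V ` V) = card {1..card V}"
    using inj by (simp add: card_image)
  ultimately have "rotated_rank V ` V = {1..card V}"
    by (intro card_subset_eq) auto
  with inj show ?thesis by (simp add: bij_betw_def)
qed

lemma bij_betw_permutations_of_set_last:
  assumes "bij_betw f V W" "x \<in> V"
  shows "bij_betw (map f) {w \<in> permutations_of_set V. last w = x}
    {w \<in> permutations_of_set W. last w = f x}"
proof -
  have inj: "inj_on f V" and W: "W = f ` V" using assms(1) by (auto simp: bij_betw_def)
  \<comment> \<open>Since \<open>x\<close> is in \<open>V\<close>, no word is empty and
    \<open>last\<close> is a genuine letter.\<close>
  have ne: "w \<noteq> []" if "w \<in> permutations_of_set V" for w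
    using permutations_of_setD(1)[OF that] assms(2) by auto
  have "inj_on (map f) {w \<in> permutations_of_set V. last w = x}"
    by (rule inj_on_mapI, rule inj_on_subset[OF inj]) (auto dest: permutations_of_setD(1))
  moreover have "map f ` {w \<in> permutations_of_set V. last w = x} =
      {w \<in> permutations_of_set W. last w = f x}"
  proof -
    have "permutations_of_set W = map f ` permutations_of_set V"
      using inj W by (simp add: permutations_of_set_image_inj)
    moreover have "last (map f w) = f x \<longleftrightarrow> last w = x" if w: "w \<in> permutations_of_set V" for w
    proof -
      have "last w \<in> V" using last_in_set[OF ne[OF w]] permutations_of_setD(1)[OF w] by simp
      then show ?thesis using ne[OF w] inj assms(2) by (simp add: last_map inj_on_eq_iff)
    qed
    ultimately show ?thesis by (auto simp: image_iff)
  qed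
  ultimately show ?thesis by (simp add: bij_betw_def)
qed

text \<open>Relabelling by \<open>rotated_rank\<close> turns \<open>des_B\<close> into
  \<open>des\<close>. As \<open>x\<close> is positive, its rank counts only the positive letters up
  to \<open>x\<close>.\<close>

lemma sum_des_B_permutations_of_set:
  assumes "finite V" "0 \<notin> V" "x \<in> V" "0 < x"
  shows "(\<Sum>w | w \<in> permutations_of_set V \<and> last w = x. monom 1 (des_B w)) =
    A_poly (card V) (card {u \<in> V. 0 < u \<and> u \<le> x})"
proof -
  let ?f = "rotated_rank V"
  have rank_x: "?f x = card {u \<in> V. 0 < u \<and> u \<le> x}"
    using assms by (simp add: rotated_rank_def)
  have des: "des_B w = des (map ?f w)" if "w \<in> permutations_of_set V" "last w = x" for w
  proof (rule des_B_map_rotate)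
    show "set w \<subseteq> V" "w \<noteq> []" using permutations_of_setD(1)[OF that(1)] assms(3) by auto
    show "0 < last w" using that(2) assms(4) by simp
  qed (rule rotated_rank_less_iff[OF assms(1,2)])
  have "(\<Sum>w | w \<in> permutations_of_set V \<and> last w = x. monom (1::int) (des_B w)) =
      (\<Sum>w \<in> {w \<in> permutations_of_set V. last w = x}. monom 1 (des (map ?f w)))"
    by (rule sum.cong) (auto simp: des)
  also have "\<dots> = (\<Sum>w \<in> {w \<in> permutations_of_set {1..card V}. last w = ?f x}. monom 1 (des w))"
    by (rule sum.reindex_bij_betw[OF
          bij_betw_permutations_of_set_last[OF bij_betw_rotated_rank[OF assms(1,2)] assms(3)]])
  finally show ?thesis by (simp add: A_poly_def perms_last_def rank_x)
qed

section \<open>Sorting signed permutations by their sign set\<close>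

definition signed_letters :: "nat \<Rightarrow> int set \<Rightarrow> int set" where
  "signed_letters n S = ({1..int n} - S) \<union> uminus ` S"

lemma mem_signed_letters_iff:
  "v \<in> signed_letters n S \<longleftrightarrow> (v \<in> {1..int n} \<and> v \<notin> S) \<or> - v \<in> S"
  by (force simp: signed_letters_def image_iff)

lemma card_signed_letters:
  assumes "S \<subseteq> {1..int n}"
  shows "card (signed_letters n S) = n"
proof -
  have fin: "finite S" using assms finite_subset by blast
  have "card (signed_letters n S) = card ({1..int n} - S) + card (uminus ` S)"
    unfolding signed_letters_def using assms fin by (intro card_Un_disjoint) auto
  also have "\<dots> = (n - card S) + card S"
    using assms fin by (simp add: card_Diff_subset card_image)
  also have "\<dots> = n" using card_mono[OF _ assms] by simp
  finally show ?thesis .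
qed

lemma signed_perms_eq_Union:
  "signed_perms n = (\<Union>S \<in> Pow {1..int n}. permutations_of_set (signed_letters n S))"
proof (intro equalityI subsetI)
  fix w assume "w \<in> signed_perms n"
  then have set: "abs ` set w = {1..int n}" and dist: "distinct (map abs w)"
    by (auto simp: signed_perms_def permutations_of_set_def)
  define S where "S = {s \<in> {1..int n}. - s \<in> set w}"
  have inj: "inj_on abs (set w)" using dist by (simp add: distinct_map)
  have nz: "v \<noteq> 0" if "v \<in> set w" for v using set that by force
  have "set w = signed_letters n S"
  proof (intro set_eqI iffI)
    fix v assume v: "v \<in> set w"
    then have abs: "\<bar>v\<bar> \<in> {1..int n}" using set by blast
    \<comment> \<open>Distinct absolute values forbid both \<open>v\<close> and \<open>- v\<close>
      in \<open>w\<close>.\<close>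
    have "- v \<notin> set w" using inj_onD[OF inj, of v "- v"] v nz[OF v] by auto
    then show "v \<in> signed_letters n S"
      using v abs by (cases "v < 0") (auto simp: mem_signed_letters_iff S_def)
  next
    fix v assume "v \<in> signed_letters n S"
    then consider "v \<in> {1..int n}" "- v \<notin> set w" | "v \<in> set w"
      by (auto simp: mem_signed_letters_iff S_def)
    then show "v \<in> set w"
    proof cases
      case 1
      then obtain u where "u \<in> set w" "\<bar>u\<bar> = v" using set by (metis imageE)
      with 1 show ?thesis by (auto simp: abs_if split: if_splits)
    qed
  qed
  moreover have "distinct w" using dist by (simp add: distinct_map)
  ultimately show "w \<in> (\<Union>S \<in> Pow {1..int n}. permutations_of_set (signed_letters n S))"
    by (auto simp: permutations_of_set_def S_def)
next
  fix w assume "w \<in> (\<Union>S \<in> Pow {1..int n}. permutations_of_set (signed_letters n S))"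
  then obtain S where S: "S \<subseteq> {1..int n}" and set: "set w = signed_letters n S"
    and dist: "distinct w" by (auto simp: permutations_of_set_def)
  have "abs ` signed_letters n S = {1..int n}"
  proof (intro equalityI subsetI)
    fix v assume "v \<in> abs ` signed_letters n S"
    then show "v \<in> {1..int n}" using S by (auto simp: signed_letters_def)
  next
    fix v assume v: "v \<in> {1..int n}"
    show "v \<in> abs ` signed_letters n S"
    proof (rule image_eqI)
      show "v = \<bar>if v \<in> S then - v else v\<bar>" using v by auto
      show "(if v \<in> S then - v else v) \<in> signed_letters n S"
        using v S by (auto simp: mem_signed_letters_iff)
    qed
  qed
  moreover have "inj_on abs (signed_letters n S)"
    using S by (intro inj_onI) (auto simp: mem_signed_letters_iff abs_if split: if_splits)
  ultimately show "w \<in> signed_perms n"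
    using set dist by (auto simp: signed_perms_def permutations_of_set_def distinct_map)
qed

text \<open>\<open>S\<close> is recovered from the negative letters; hence different sign sets give
  disjoint classes of words.\<close>

lemma signed_letters_inject:
  assumes "S \<subseteq> {1..int n}" "T \<subseteq> {1..int n}" "signed_letters n S = signed_letters n T"
  shows "S = T"
proof -
  have "s \<in> U \<longleftrightarrow> s \<in> {1..int n} \<and> - s \<in> signed_letters n U"
    if "U \<subseteq> {1..int n}" for s U
    using that by (auto simp: mem_signed_letters_iff)
  with assms show ?thesis by blast
qed

text \<open>A last letter \<open>+i\<close> forces \<open>i\<close> out of the sign set. Each
  remaining \<open>S\<close> fixes an alphabet of \<open>n\<close> letters, in which
  \<open>i\<close> has rank \<open>i\<close> minus the number of elements of \<open>S\<close> below
  it.\<close>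

lemma B_poly_eq_sum_sign_sets:
  assumes "1 \<le> i" "i \<le> n"
  shows "B_poly n (int i) =
    (\<Sum>S \<in> Pow ({1..int n} - {int i}). A_poly n (i - card (S \<inter> {1..<int i})))"
proof -
  let ?P = "\<lambda>S. {w. w \<in> permutations_of_set (signed_letters n S) \<and> last w = int i}"
  have mem: "int i \<in> signed_letters n S \<longleftrightarrow> int i \<notin> S" if "S \<subseteq> {1..int n}" for S
    using that assms by (auto simp: mem_signed_letters_iff)
  have "last w \<in> signed_letters n S"
    if "w \<in> permutations_of_set (signed_letters n S)" "S \<subseteq> {1..int n}" for w S
  proof -
    have "w \<noteq> []"
      using permutations_of_setD(1)[OF that(1)] card_signed_letters[OF that(2)] assms by auto
    then show ?thesis using last_in_set permutations_of_setD(1)[OF that(1)] by blast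
  qed
  then have "S \<in> Pow ({1..int n} - {int i})"
    if "w \<in> ?P S" "S \<subseteq> {1..int n}" for w S
    using that mem[of S] by fastforce
  then have eq: "signed_perms_last n (int i) = (\<Union>S \<in> Pow ({1..int n} - {int i}). ?P S)"
    by (auto simp: signed_perms_last_def signed_perms_eq_Union)
  have "B_poly n (int i) =
      (\<Sum>S \<in> Pow ({1..int n} - {int i}). \<Sum>w \<in> ?P S. monom 1 (des_B w))"
    unfolding B_poly_def eq
  proof (rule sum.UNION_disjoint)
    show "\<forall>S \<in> Pow ({1..int n} - {int i}). finite (?P S)" by simp
    show "\<forall>S \<in> Pow ({1..int n} - {int i}). \<forall>T \<in> Pow ({1..int n} - {int i}).
        S \<noteq> T \<longrightarrow> ?P S \<inter> ?P T = {}"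
    proof (intro ballI impI)
      fix S T assume "S \<in> Pow ({1..int n} - {int i})" "T \<in> Pow ({1..int n} - {int i})" "S \<noteq> T"
      then have "signed_letters n S \<noteq> signed_letters n T"
        using signed_letters_inject[of S n T] by blast
      then show "?P S \<inter> ?P T = {}" by (auto dest!: permutations_of_setD(1))
    qed
  qed simp
  also have "\<dots> = (\<Sum>S \<in> Pow ({1..int n} - {int i}). A_poly n (i - card (S \<inter> {1..<int i})))"
  proof (rule sum.cong[OF refl])
    fix S assume "S \<in> Pow ({1..int n} - {int i})"
    then have S: "S \<subseteq> {1..int n}" "int i \<notin> S" by auto
    let ?V = "signed_letters n S"
    \<comment> \<open>As \<open>i\<close> is not in \<open>S\<close>, only elements strictly below
      \<open>i\<close> are removed.\<close>
    have "{u \<in> ?V. 0 < u \<and> u \<le> int i} = {1..int i} - S \<inter> {1..<int i}"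
      using S assms by (auto simp: mem_signed_letters_iff order.order_iff_strict)
    moreover have "card ({1..int i} - S \<inter> {1..<int i}) = i - card (S \<inter> {1..<int i})"
      by (subst card_Diff_subset) auto
    ultimately have "card {u \<in> ?V. 0 < u \<and> u \<le> int i} = i - card (S \<inter> {1..<int i})"
      by simp
    moreover have "finite ?V"
      using S finite_subset[OF S(1)] by (simp add: signed_letters_def)
    moreover have "0 \<notin> ?V" using S by (auto simp: mem_signed_letters_iff)
    moreover have "int i \<in> ?V" using S mem by blast
    ultimately show "(\<Sum>w \<in> ?P S. monom 1 (des_B w)) = A_poly n (i - card (S \<inter> {1..<int i}))"
      using sum_des_B_permutations_of_set[of ?V "int i"] card_signed_letters[OF S(1)] assms by simp
  qed
  finally show ?thesis .
qed

section \<open>Counting the sign sets\<close>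

lemma sum_Pow_card:
  fixes f :: "nat \<Rightarrow> 'b::semiring_1"
  assumes "finite A"
  shows "(\<Sum>S \<in> Pow A. f (card S)) = (\<Sum>k = 0..card A. of_nat (card A choose k) * f k)"
proof -
  have "(\<Sum>S \<in> Pow A. f (card S)) =
      (\<Sum>k = 0..card A. \<Sum>S | S \<in> Pow A \<and> card S = k. f (card S))"
    using assms by (intro sum.group[symmetric]) (auto intro: card_mono)
  also have "\<dots> = (\<Sum>k = 0..card A. of_nat (card A choose k) * f k)"
    using n_subsets[OF assms] by (intro sum.cong) auto
  finally show ?thesis .
qed

text \<open>A subset of the union is a pair of subsets of \<open>A\<close> and \<open>B\<close>; the
  second one is free, with \<open>2 ^ card B\<close> choices.\<close>

lemma sum_Pow_Un_disjoint:
  fixes f :: "'a set \<Rightarrow> 'b::semiring_1"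
  assumes "finite A" "finite B" "A \<inter> B = {}"
  shows "(\<Sum>S \<in> Pow (A \<union> B). f (S \<inter> A)) = 2 ^ card B * (\<Sum>S \<in> Pow A. f S)"
proof -
  have "(\<Sum>S \<in> Pow (A \<union> B). f (S \<inter> A)) = (\<Sum>(S, T) \<in> Pow A \<times> Pow B. f S)"
    by (rule sum.reindex_bij_witness[of _ "\<lambda>(S, T). S \<union> T" "\<lambda>S. (S \<inter> A, S \<inter> B)"])
      (use assms in auto)
  also have "\<dots> = (\<Sum>S \<in> Pow A. 2 ^ card B * f S)"
    using assms by (simp add: sum.cartesian_product[symmetric] card_Pow)
  finally show ?thesis by (simp add: sum_distrib_left)
qed

theorem theorem1p2:
  fixes n i :: nat
  assumes "n \<ge> 1" and "1 \<le> i" and "i \<le> n"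
  shows "B_poly n (int i) =
    2 ^ (n - i) * (\<Sum>j=0..i-1. of_nat ((i - 1) choose j) * A_poly n (i - j))"
proof -
  let ?A = "{1..<int i}" and ?B = "{int i<..int n}"
  \<comment> \<open>Splitting at \<open>i\<close> separates the signs that shift the rank of
    \<open>i\<close> from those above \<open>i\<close>, which leave it fixed.\<close>
  have "{1..int n} - {int i} = ?A \<union> ?B" using assms by auto
  then have "B_poly n (int i) = (\<Sum>S \<in> Pow (?A \<union> ?B). A_poly n (i - card (S \<inter> ?A)))"
    using B_poly_eq_sum_sign_sets[OF assms(2,3)] by simp
  also have "\<dots> = 2 ^ card ?B * (\<Sum>S \<in> Pow ?A. A_poly n (i - card S))"
    by (rule sum_Pow_Un_disjoint) auto
  also have "(\<Sum>S \<in> Pow ?A. A_poly n (i - card S)) =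
      (\<Sum>j = 0..card ?A. of_nat (card ?A choose j) * A_poly n (i - j))"
    by (rule sum_Pow_card) simp
  also have "card ?A = i - 1" using assms by (simp add: nat_diff_distrib)
  also have "card ?B = n - i" using assms by (simp add: nat_diff_distrib)
  finally show ?thesis .
qed

end
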